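(* Let $(X,\|\cdot\|)$ be an admissible matrix space in $\mathcal{M}_n(\mathbb{F})$. For any $\alpha\in\mathcal{R}(X,\|\cdot\|)$, there is a neighbourhood $T$ of $0$ in $[-1,1]$, and matrices $u_t,w_t\in\mathcal{U}_n(\mathbb{F})$ and $c(t)\in X$ for each $t\in T$, such that (i) $\alpha_x(t)=u_txw_t+c(t)$ for all $x\in X$ and $t\in T$; (ii) $c(0)=0$ and $u_0=w_0=I$; (iii) the maps $t\mapsto c(t)$ and $t\mapsto u_txw_t$ are both differentiable at $t=0$, for any $x\in X$; and (iv) the maps $t\mapsto u_t$ and $t\mapsto w_t$ are continuous at $t=0$.
   Context: Throughout, $n\ge 2$ is an integer, $\mathbb{F}\in\{\mathbb{R},\mathbb{C}\}$, and $\mathcal{M}_n(\mathbb{F})$ is the algebra of $n\times n$ matrices over $\mathbb{F}$; $a^*$ is the conjugate transpose of $a$ (the transpose if $\mathbb{F}=\mathbb{R}$), $I$ is the identity matrix, $e_{ij}$ are the matrix units, and $\mathcal{U}_n(\mathbb{F})$ is the set of unitary (orthogonal, if $\mathbb{F}=\mathbb{R}$) matrices. A norm on $\mathcal{M}_n(\mathbb{F})$ is unitarily invariant if $\|a\|=\|uaw\|$ for all $a\in\mathcal{M}_n(\mathbb{F})$ and $u,w\in\mathcal{U}_n(\mathbb{F})$. A test set on $\mathcal{M}_n(\mathbb{F})$ is a finite set $\Gamma$ of real-linear maps $\mathcal{M}_n(\mathbb{F})\to\mathcal{M}_n(\mathbb{F})$ containing the identity map and with $\gamma(I)=I$ for all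 $\gamma\in\Gamma$. For a real-linear subspace $X\subseteq\mathcal{M}_n(\mathbb{F})$, put $X^\gamma=\{y\in\mathcal{M}_n(\mathbb{F}): xy=y\gamma(x)\ \forall x\in X\}$ and $X^\Gamma=\bigcup_{\gamma\in\Gamma}X^\gamma$. $X$ is $\Gamma$-large in $\mathcal{M}_n(\mathbb{F})$ if $I\in X$ and $X^\Gamma=\mathbb{F}I$. For a unitarily invariant norm, $(X,\|\cdot\|)$ has the $\Gamma$-isometry property if every real-linear isometry $A:X\to X$ has the form $A(x)=u\,\gamma(x)\,w$ $(x\in X)$ for some $u,w\in\mathcal{U}_n(\mathbb{F})$ and $\gamma\in\Gamma$. $(X,\|\cdot\|)$, with $X$ a real-linear subspace of $\mathcal{M}_n(\mathbb{F})$ and $\|\cdot\|$ a unitarily invariant norm on $\mathcal{M}_n(\mathbb{F})$, is an admissible matrix space (in $\mathcal{M}_n(\mathbb{F})$) if: (a) there is a test set $\Gamma$ such that $X$ is $\Gamma$-large and $(X,\|\cdot\|)$ has the $\Gamma$-isometry property; (b) there exist scalars $\lambda_i\in\mathbb{F}$, $1\le i\le n$, such that $e_{ii}\in X$ and $e_{1i}+\lambda_i e_{i1}\in X$; (c) $x^*\in X$ for every $x\in X$. A rigid motion of a normed space $(X,\|\cdot\|)$ is a family of continuous paths $\alpha=\{\alpha_x:[-1,1]\to X\}_{x\in X}$ with $\alpha_x(0)=x$, $\alpha_x$ differentiable at $t=0$ for all $x\in X$, and $\|\alpha_x(t)-\alpha_y(t)\|=\|x-y\|$ for all $x,y\in X$,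 $t\in[-1,1]$. $\mathcal{R}(X,\|\cdot\|)$ is the set of all rigid motions. *)

theory Defs
  imports "HOL-Analysis.Analysis" "Jordan_Normal_Form.Conjugate"
begin

text \<open>
  The scalar field is either the reals or the complex numbers. The class below has exactly these
  two members up to isomorphism of normed fields with conjugation (lemma
  \<open>real_or_complex_classification\<close>), so a statement about \<open>'a::real_or_complex\<close> covers both
  cases at once. On the reals \<open>conjugate\<close> is the identity, on the complex numbers it is \<open>cnj\<close>.
\<close>

class real_or_complex = conjugatable_field + real_normed_field + euclidean_space +
  assumes mult_conjugate_scaleR: "z * conjugate z = (norm z)\<^sup>2 *\<^sub>R 1"
    and imaginary_unit_scaleR:
      "\<exists>\<iota>. (\<iota> = 0 \<or> \<iota> * \<iota> = - 1) \<and> (\<forall>z. \<exists>a b. z = a *\<^sub>R 1 + b *\<^sub>R \<iota>)"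

instance real :: real_or_complex
  by standard (auto simp: power2_eq_square)

instance complex :: real_or_complex
proof
  fix z :: complex
  show "z * conjugate z = (norm z)\<^sup>2 *\<^sub>R 1"
    by (simp add: complex_norm_square[symmetric] scaleR_conv_of_real del: of_real_power)
  show "\<exists>\<iota>::complex. (\<iota> = 0 \<or> \<iota> * \<iota> = - 1) \<and> (\<forall>z. \<exists>a b. z = a *\<^sub>R 1 + b *\<^sub>R \<iota>)"
    by (rule exI[of _ \<i>]) (auto simp: complex_eq_iff)
qed

lemma mult_conjugate: "z * conjugate z = (of_real ((norm z)\<^sup>2) :: 'a::real_or_complex)"
  by (simp only: mult_conjugate_scaleR of_real_def)

lemma imaginary_unit:
  "\<exists>\<iota>::'a::real_or_complex. (\<iota> = 0 \<or> \<iota> * \<iota> = - 1) \<and> (\<forall>z. \<exists>a b. z = of_real a + of_real b * \<iota>)"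
  using imaginary_unit_scaleR by (simp add: scaleR_conv_of_real)

lemma conjugate_of_real_roc: "conjugate (of_real r :: 'a::real_or_complex) = of_real r"
proof (cases "r = 0")
  case False
  have "of_real r * conjugate (of_real r :: 'a) = of_real r * of_real r"
    using mult_conjugate[of "of_real r :: 'a"] by (simp add: power2_eq_square)
  with False show ?thesis by simp
qed simp

lemma real_or_complex_classification:
  "(\<exists>\<phi> :: 'a::real_or_complex \<Rightarrow> real. bij \<phi> \<and>
      (\<forall>x y. \<phi> (x + y) = \<phi> x + \<phi> y \<and> \<phi> (x * y) = \<phi> x * \<phi> y) \<and> (\<forall>r. \<phi> (of_real r) = r) \<and>
      (\<forall>x. norm (\<phi> x) = norm x \<and> \<phi> (conjugate x) = \<phi> x)) \<or>
   (\<exists>\<phi> :: 'a \<Rightarrow> complex. bij \<phi> \<and>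
      (\<forall>x y. \<phi> (x + y) = \<phi> x + \<phi> y \<and> \<phi> (x * y) = \<phi> x * \<phi> y) \<and> (\<forall>r. \<phi> (of_real r) = of_real r) \<and>
      (\<forall>x. norm (\<phi> x) = norm x \<and> \<phi> (conjugate x) = cnj (\<phi> x)))"
proof -
  obtain \<iota> :: 'a where \<iota>: "\<iota> = 0 \<or> \<iota> * \<iota> = - 1" 
    and rep: "\<And>z. \<exists>a b. z = of_real a + of_real b * \<iota>"
    using imaginary_unit by blast
  from \<iota> show ?thesis
  proof
    assume "\<iota> = 0"
    then have rep': "\<exists>a. z = of_real a" for z :: 'a using rep[of z] by auto
    define \<phi> :: "'a \<Rightarrow> real" where "\<phi> = inv of_real"
    have \<phi>: "\<phi> (of_real r) = r" for r unfolding \<phi>_def by (simp add: inj_of_real inv_f_f)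
    have "bij \<phi>"
    proof (rule bijI')
      show "\<phi> x = \<phi> y \<longleftrightarrow> x = y" for x y using rep'[of x] rep'[of y] \<phi> by auto
      show "\<exists>x. r = \<phi> x" for r using \<phi>[of r, symmetric] by (rule exI)
    qed
    moreover have "\<phi> (x + y) = \<phi> x + \<phi> y" "\<phi> (x * y) = \<phi> x * \<phi> y" for x y
      using rep'[of x] rep'[of y] \<phi> by (auto simp flip: of_real_add of_real_mult)
    moreover have "norm (\<phi> x) = norm x" "\<phi> (conjugate x) = \<phi> x" for x
      using rep'[of x] \<phi> by (auto simp: conjugate_of_real_roc)
    ultimately show ?thesis using \<phi> by (intro disjI1 exI[of _ \<phi>]) simp
  next
    assume sq: "\<iota> * \<iota> = - 1"
    have "(norm \<iota>)\<^sup>2 = 1"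
      using arg_cong[OF sq, of norm] by (simp add: norm_mult power2_eq_square)
    then have "\<iota> * conjugate \<iota> = \<iota> * (- \<iota>)" 
      using mult_conjugate[of \<iota>] sq by simp
    moreover have "\<iota> \<noteq> 0" using sq by auto
    ultimately have c\<iota>: "conjugate \<iota> = - \<iota>" by (metis mult_left_cancel)
    define g :: "complex \<Rightarrow> 'a" where "g z = of_real (Re z) + of_real (Im z) * \<iota>" for z
    have g_add: "g (x + y) = g x + g y" for x y by (simp add: g_def algebra_simps)
    have g_mult: "g (x * y) = g x * g y" for x y
    proof -
      have "g x * g y = of_real (Re x * Re y) + of_real (Re x * Im y + Im x * Re y) * \<iota> 
              + of_real (Im x * Im y) * (\<iota> * \<iota>)" 
        by (simp add: g_def algebra_simps)
      then show ?thesis unfolding sq by (simp add: g_def algebra_simps)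
    qed
    have g_real: "g (of_real r) = of_real r" for r by (simp add: g_def)
    have g_cnj: "g (cnj x) = conjugate (g x)" for x
      by (simp add: g_def conjugate_dist_add conjugate_dist_mul conjugate_of_real_roc c\<iota>)
    have g_norm: "norm (g x) = norm x" for x
    proof -
      have "(of_real ((norm (g x))\<^sup>2) :: 'a) = g x * g (cnj x)"
        by (simp only: g_cnj mult_conjugate)
      also have "\<dots> = g (of_real ((norm x)\<^sup>2))"
        by (simp only: g_mult[symmetric] complex_norm_square)
      also have "\<dots> = of_real ((norm x)\<^sup>2)" by (rule g_real)
      finally have "(norm (g x))\<^sup>2 = (norm x)\<^sup>2" by (simp only: of_real_eq_iff)
      then show ?thesis by simp
    qed
    have "inj g"
    proof (rule injI)
      fix x y assume "g x = g y"
      moreover have "g x = g (x - y) + g y" by (simp flip: g_add)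
      ultimately have "norm (x - y) = 0" by (simp flip: g_norm)
      then show "x = y" by simp
    qed
    moreover have "surj g"
      unfolding surj_def
    proof
      fix z
      obtain a b where "z = of_real a + of_real b * \<iota>" using rep by blast
      then have "z = g (Complex a b)" by (simp add: g_def)
      then show "\<exists>x. z = g x" ..
    qed
    ultimately have "bij g" by (simp add: bij_def)
    define \<phi> where "\<phi> = inv g"
    have \<phi>g: "\<phi> (g x) = x" for x unfolding \<phi>_def using \<open>inj g\<close> by simp
    have g\<phi>: "g (\<phi> x) = x" for x unfolding \<phi>_def using \<open>surj g\<close> by (rule surj_f_inv_f)
    have "bij \<phi>" unfolding \<phi>_def using \<open>bij g\<close> by (rule bij_imp_bij_inv)
    moreover have "\<phi> (x + y) = \<phi> x + \<phi> y" "\<phi> (x * y) = \<phi> x * \<phi> y" for x y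
      by (metis g_add \<phi>g g\<phi>, metis g_mult \<phi>g g\<phi>)
    moreover have "\<phi> (of_real r) = of_real r" for r by (metis g_real \<phi>g)
    moreover have "norm (\<phi> x) = norm x" "\<phi> (conjugate x) = cnj (\<phi> x)" for x
      by (metis g_norm g\<phi>, metis g_cnj \<phi>g g\<phi>)
    ultimately show ?thesis by (intro disjI2 exI[of _ \<phi>]) simp
  qed
qed


definition conj_transpose :: "'a::real_or_complex ^ 'n ^ 'n \<Rightarrow> 'a ^ 'n ^ 'n" where
  "conj_transpose a = (\<chi> i j. conjugate (a $ j $ i))"

definition unitary_matrices :: "('a::real_or_complex ^ 'n ^ 'n) set" where
  "unitary_matrices = {u. conj_transpose u ** u = mat 1 \<and> u ** conj_transpose u = mat 1}"

definition matrix_unit :: "'n \<Rightarrow> 'n \<Rightarrow> 'a::real_or_complex ^ 'n ^ 'n" where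
  "matrix_unit i j = (\<chi> k l. if k = i \<and> l = j then 1 else 0)"

definition scalar_mult :: "'a::real_or_complex \<Rightarrow> 'a ^ 'n ^ 'n \<Rightarrow> 'a ^ 'n ^ 'n" where
  "scalar_mult c a = (\<chi> i j. c * a $ i $ j)"


text \<open>
  Norms on the matrix space are arbitrary functions subject to the norm axioms; they are unrelated
  to the type class operation \<open>norm\<close>, which on matrices is the Frobenius norm.
\<close>

definition is_matrix_norm :: "('a::real_or_complex ^ 'n ^ 'n \<Rightarrow> real) \<Rightarrow> bool" where
  "is_matrix_norm N \<longleftrightarrow>
     (\<forall>a. 0 \<le> N a) \<and> (\<forall>a. N a = 0 \<longleftrightarrow> a = 0) \<and>
     (\<forall>c a. N (scalar_mult c a) = norm c * N a) \<and>
     (\<forall>a b. N (a + b) \<le> N a + N b)"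

definition unitarily_invariant_norm :: "('a::real_or_complex ^ 'n ^ 'n \<Rightarrow> real) \<Rightarrow> bool" where
  "unitarily_invariant_norm N \<longleftrightarrow>
     is_matrix_norm N \<and>
     (\<forall>a. \<forall>u\<in>unitary_matrices. \<forall>w\<in>unitary_matrices. N a = N (u ** a ** w))"


text \<open>\<open>linear\<close> and \<open>subspace\<close> refer to the real vector space structure, also for complex matrices.\<close>

definition test_set :: "('a::real_or_complex ^ 'n ^ 'n \<Rightarrow> 'a ^ 'n ^ 'n) set \<Rightarrow> bool" where
  "test_set \<Gamma> \<longleftrightarrow> finite \<Gamma> \<and> (\<forall>\<gamma>\<in>\<Gamma>. linear \<gamma>) \<and> id \<in> \<Gamma> \<and> (\<forall>\<gamma>\<in>\<Gamma>. \<gamma> (mat 1) = mat 1)"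

definition twisted_commutant ::
    "('a::real_or_complex ^ 'n ^ 'n) set \<Rightarrow> ('a ^ 'n ^ 'n \<Rightarrow> 'a ^ 'n ^ 'n) \<Rightarrow> ('a ^ 'n ^ 'n) set" where
  "twisted_commutant X \<gamma> = {y. \<forall>x\<in>X. x ** y = y ** \<gamma> x}"

text \<open>\<open>range mat\<close> is the set of scalar multiples of the identity matrix.\<close>

definition large ::
    "('a::real_or_complex ^ 'n ^ 'n \<Rightarrow> 'a ^ 'n ^ 'n) set \<Rightarrow> ('a ^ 'n ^ 'n) set \<Rightarrow> bool" where
  "large \<Gamma> X \<longleftrightarrow> mat 1 \<in> X \<and> (\<Union>\<gamma>\<in>\<Gamma>. twisted_commutant X \<gamma>) = range mat"

definition linear_isometry_on ::
    "('v::real_vector) set \<Rightarrow> ('v \<Rightarrow> real) \<Rightarrow> ('v \<Rightarrow> 'v) \<Rightarrow> bool" where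
  "linear_isometry_on X N A \<longleftrightarrow>
     (\<forall>x\<in>X. A x \<in> X) \<and>
     (\<forall>x\<in>X. \<forall>y\<in>X. A (x + y) = A x + A y) \<and>
     (\<forall>r. \<forall>x\<in>X. A (r *\<^sub>R x) = r *\<^sub>R A x) \<and>
     (\<forall>x\<in>X. \<forall>y\<in>X. N (A x - A y) = N (x - y))"

definition isometry_property ::
    "('a::real_or_complex ^ 'n ^ 'n \<Rightarrow> 'a ^ 'n ^ 'n) set \<Rightarrow> ('a ^ 'n ^ 'n) set \<Rightarrow>
      ('a ^ 'n ^ 'n \<Rightarrow> real) \<Rightarrow> bool" where
  "isometry_property \<Gamma> X N \<longleftrightarrow>
     (\<forall>A. linear_isometry_on X N A \<longrightarrow>
       (\<exists>u\<in>unitary_matrices. \<exists>w\<in>unitary_matrices. \<exists>\<gamma>\<in>\<Gamma>. \<forall>x\<in>X. A x = u ** \<gamma> x ** w))"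

text \<open>
  Rows and columns are indexed by an arbitrary finite type; \<open>i\<^sub>1\<close> is the index that plays the role
  of the index 1 in \<open>{1..n}\<close>.
\<close>

definition admissible_matrix_space ::
    "'n \<Rightarrow> ('a::real_or_complex ^ 'n ^ 'n) set \<Rightarrow> ('a ^ 'n ^ 'n \<Rightarrow> real) \<Rightarrow> bool" where
  "admissible_matrix_space i\<^sub>1 X N \<longleftrightarrow>
     subspace X \<and> unitarily_invariant_norm N \<and>
     (\<exists>\<Gamma>. test_set \<Gamma> \<and> large \<Gamma> X \<and> isometry_property \<Gamma> X N) \<and>
     (\<exists>l :: 'n \<Rightarrow> 'a. \<forall>i. matrix_unit i i \<in> X \<and>
        matrix_unit i\<^sub>1 i + scalar_mult (l i) (matrix_unit i i\<^sub>1) \<in> X) \<and>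
     (\<forall>x\<in>X. conj_transpose x \<in> X)"


text \<open>
  Continuity and differentiability of paths in the normed space \<open>(X, N)\<close>. As the matrix spaces
  are finite-dimensional, for a matrix norm \<open>N\<close> these agree with the notions given by the usual
  topology.
\<close>

definition path_continuous_on :: "('v::real_vector \<Rightarrow> real) \<Rightarrow> real set \<Rightarrow> (real \<Rightarrow> 'v) \<Rightarrow> bool" where
  "path_continuous_on N S f \<longleftrightarrow> (\<forall>t\<in>S. ((\<lambda>s. N (f s - f t)) \<longlongrightarrow> 0) (at t within S))"

definition path_differentiable_at ::
    "('v::real_vector) set \<Rightarrow> ('v \<Rightarrow> real) \<Rightarrow> real set \<Rightarrow> (real \<Rightarrow> 'v) \<Rightarrow> real \<Rightarrow> bool" where
  "path_differentiable_at X N S f t \<longleftrightarrow>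
     (\<exists>d\<in>X. ((\<lambda>s. N ((f s - f t) /\<^sub>R (s - t) - d)) \<longlongrightarrow> 0) (at t within S))"

text \<open>
  A rigid motion is a family of paths indexed by \<open>X\<close> and defined on \<open>[-1, 1]\<close>; the values of
  \<open>\<alpha> x t\<close> for \<open>x \<notin> X\<close> or \<open>t \<notin> [-1, 1]\<close> are irrelevant.
\<close>

definition rigid_motions :: "('v::real_vector) set \<Rightarrow> ('v \<Rightarrow> real) \<Rightarrow> ('v \<Rightarrow> real \<Rightarrow> 'v) set" where
  "rigid_motions X N = {\<alpha>.
     (\<forall>x\<in>X. (\<forall>t\<in>{-1..1}. \<alpha> x t \<in> X) \<and> path_continuous_on N {-1..1} (\<alpha> x) \<and>
        \<alpha> x 0 = x \<and> path_differentiable_at X N {-1..1} (\<alpha> x) 0) \<and>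
     (\<forall>x\<in>X. \<forall>y\<in>X. \<forall>t\<in>{-1..1}. N (\<alpha> x t - \<alpha> y t) = N (x - y))}"

end

theory Submission
  imports Defs
begin

text \<open>
  Put \<open>c(t) = \<alpha>\<^sub>0(t)\<close> and \<open>A\<^sub>t(x) = \<alpha>\<^sub>x(t) - c(t)\<close>. Each \<open>A\<^sub>t\<close> is a distance preserving self-map of
  \<open>X\<close> that fixes \<open>0\<close>, nothing more is known a priori. Since \<open>X\<close> has finite dimension, closed balls
  are compact and such a map is onto (\<open>isometry_surj\<close>); by the Mazur--Ulam theorem it is then
  real-linear, and the isometry property gives \<open>A\<^sub>t(x) = u\<^sub>t \<gamma>\<^sub>t(x) w\<^sub>t\<close> with \<open>\<gamma>\<^sub>t \<in> \<Gamma>\<close>.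

  It remains to control this representation near \<open>t = 0\<close>, where \<open>A\<^sub>t(x) \<longrightarrow> A\<^sub>0(x) = x\<close> for each \<open>x\<close>.
  The unitary group is compact, so along a suitable sequence \<open>t\<^sub>k \<longrightarrow> 0\<close> with constant \<open>\<gamma>\<close> the \<open>u\<close>'s
  converge to a unitary \<open>v\<close>. As \<open>\<gamma>(I) = I\<close>, the products \<open>u w = A\<^sub>t(I)\<close> tend to \<open>I\<close>, hence the \<open>w\<close>'s
  tend to \<open>v\<^sup>*\<close>. In the limit \<open>x = v \<gamma>(x) v\<^sup>*\<close>, that is \<open>x v = v \<gamma>(x)\<close> on \<open>X\<close>: the matrix \<open>v\<close> lies in
  \<open>X\<^sup>\<gamma>\<close>. Largeness of \<open>X\<close> makes \<open>v\<close> a scalar of modulus 1, and then \<open>\<gamma>\<close> is the identity on \<open>X\<close>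
  (\<open>twisted_representation_limit\<close>). This has two consequences.

  First, a \<open>\<gamma> \<in> \<Gamma>\<close> that moves some element of \<open>X\<close> cannot occur for \<open>t\<close> close to \<open>0\<close>; as \<open>\<Gamma>\<close> is finite,
  \<open>A\<^sub>t(x) = u\<^sub>t x w\<^sub>t\<close> throughout a neighbourhood of \<open>0\<close> (\<open>eventually_untwisted\<close>). Second, the only
  remaining obstacle to \<open>u\<^sub>t \<longrightarrow> I\<close> is a scalar phase, because the pair \<open>(u\<^sub>t, w\<^sub>t)\<close> can be replaced by
  \<open>(\<mu> u\<^sub>t, \<mu>\<^sup>-\<^sup>1 w\<^sub>t)\<close>. Choosing the phase so that one fixed diagonal entry of \<open>u\<^sub>t\<close> is real and nonnegative
  leaves \<open>I\<close> as the only possible limit point, which yields continuity at \<open>0\<close>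
  (\<open>normalized_representation_tendsto\<close>). Differentiability is inherited from \<open>\<alpha>\<close>.
\<close>

section \<open>Isometries of finite-dimensional normed spaces\<close>

text \<open>
  The norm is a parameter and not the class operation, because the norms of interest live on a type
  whose class norm is a different one.
\<close>

locale real_norm =
  fixes N :: "'v::real_vector \<Rightarrow> real"
  assumes nonneg: "0 \<le> N x"
    and eq_0_iff: "N x = 0 \<longleftrightarrow> x = 0"
    and scaleR: "N (r *\<^sub>R x) = \<bar>r\<bar> * N x"
    and triangle: "N (x + y) \<le> N x + N y"
begin

lemma zero: "N 0 = 0"
  by (simp add: eq_0_iff)

lemma minus: "N (- x) = N x"
  using scaleR[of "-1" x] by simp

lemma minus_commute: "N (x - y) = N (y - x)"
  using minus[of "x - y"] by simp

lemma triangle_diff: "N (x - z) \<le> N (x - y) + N (y - z)"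
  using triangle[of "x - y" "y - z"] by simp

lemma diff_eq_0_iff: "N (x - y) = 0 \<longleftrightarrow> x = y"
  by (simp add: eq_0_iff)

definition isometric_on :: "'v set \<Rightarrow> ('v \<Rightarrow> 'v) \<Rightarrow> bool" where
  "isometric_on X f \<longleftrightarrow> (\<forall>x\<in>X. \<forall>y\<in>X. N (f x - f y) = N (x - y))"

definition surj_isometry :: "'v set \<Rightarrow> ('v \<Rightarrow> 'v) \<Rightarrow> bool" where
  "surj_isometry X f \<longleftrightarrow> bij_betw f X X \<and> isometric_on X f"

lemma surj_isometry_comp:
  assumes "surj_isometry X f" "surj_isometry X g"
  shows "surj_isometry X (g \<circ> f)"
  using assms bij_betw_trans[of f X X g X] bij_betwE[of f X X]
  by (auto simp: surj_isometry_def isometric_on_def)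

lemma surj_isometry_inv_into:
  assumes "surj_isometry X f"
  shows "surj_isometry X (inv_into X f)"
proof -
  have f: "bij_betw f X X" "isometric_on X f"
    using assms by (auto simp: surj_isometry_def)
  have "N (inv_into X f x - inv_into X f y) = N (x - y)" if "x \<in> X" "y \<in> X" for x y
  proof -
    have "inv_into X f x \<in> X" "inv_into X f y \<in> X"
      using bij_betwE[OF bij_betw_inv_into[OF f(1)]] that by auto
    then have "N (f (inv_into X f x) - f (inv_into X f y)) = N (inv_into X f x - inv_into X f y)"
      using f(2) by (auto simp: isometric_on_def)
    then show ?thesis
      using that f(1) by (simp add: bij_betw_inv_into_right)
  qed
  then show ?thesis
    using bij_betw_inv_into[OF f(1)] by (simp add: surj_isometry_def isometric_on_def)
qed

lemma surj_isometry_reflection: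
  assumes "subspace X" "p \<in> X"
  shows "surj_isometry X (\<lambda>x. p - x)"
proof -
  have "bij_betw (\<lambda>x. p - x) X X"
    by (rule bij_betwI[where g = "\<lambda>x. p - x"]) (use assms in \<open>auto intro: subspace_diff\<close>)
  moreover have "N (p - x - (p - y)) = N (x - y)" for x y
    using minus_commute[of x y] by simp
  ultimately show ?thesis
    by (simp add: surj_isometry_def isometric_on_def)
qed

text \<open>
  Vaisala's argument. Let \<open>\<psi>\<close> be the reflection in the midpoint \<open>z\<close>, which swaps \<open>a\<close> and \<open>b\<close>. If
  \<open>h\<close> is a surjective isometry fixing \<open>a\<close> and \<open>b\<close>, then so is \<open>\<psi> h\<^sup>-\<^sup>1 \<psi> h\<close>, and it moves \<open>z\<close> exactly
  twice as far as \<open>h\<close> does. But no such isometry moves \<open>z\<close> further than \<open>2 N (z - a)\<close>, so the supremum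
  of the displacements of \<open>z\<close> is finite and at least its own double, hence zero.
\<close>

lemma midpoint_fixed:
  assumes X: "subspace X" and ab: "a \<in> X" "b \<in> X"
    and g: "surj_isometry X g" "g a = a" "g b = b"
  shows "g ((1/2) *\<^sub>R (a + b)) = (1/2) *\<^sub>R (a + b)"
proof -
  define z where "z = (1/2) *\<^sub>R (a + b)"
  define \<psi> where "\<psi> = (\<lambda>x. a + b - x)"
  define G where "G = {g. surj_isometry X g \<and> g a = a \<and> g b = b}"
  define L where "L = (SUP g\<in>G. N (g z - z))"
  have zX: "z \<in> X"
    using X ab by (auto simp: z_def intro: subspace_scale subspace_add)
  have z2: "a + b = 2 *\<^sub>R z"
    by (simp add: z_def)
  have \<psi>: "surj_isometry X \<psi>"
    unfolding \<psi>_def using X ab by (intro surj_isometry_reflection subspace_add)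
  have bdd: "bdd_above ((\<lambda>g. N (g z - z)) ` G)"
  proof (rule bdd_aboveI2)
    fix h assume "h \<in> G"
    then have "N (h z - a) = N (z - a)"
      using zX ab unfolding G_def surj_isometry_def isometric_on_def by (metis (mono_tags, lifting) mem_Collect_eq)
    then show "N (h z - z) \<le> 2 * N (z - a)"
      using triangle_diff[of "h z" z a] minus_commute[of a z] by simp
  qed
  have double: "2 * N (h z - z) \<le> L" if h: "h \<in> G" for h
  proof -
    define k where "k = \<psi> \<circ> (inv_into X h \<circ> (\<psi> \<circ> h))"
    have hs: "surj_isometry X h" "h a = a" "h b = b"
      using h by (auto simp: G_def)
    have hb: "bij_betw h X X"
      using hs by (simp add: surj_isometry_def)
    have inv_ab: "inv_into X h a = a" "inv_into X h b = b"
      using hs hb ab by (metis bij_betw_def inv_into_f_f)+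
    have "surj_isometry X k"
      unfolding k_def by (intro surj_isometry_comp surj_isometry_inv_into hs \<psi>)
    then have k: "k \<in> G"
      by (simp add: G_def k_def hs inv_ab \<psi>_def)
    have hz: "h z \<in> X"
      using bij_betwE[OF hb] zX by auto
    have \<psi>hz: "\<psi> (h z) \<in> X"
      using \<psi> hz bij_betwE[of \<psi> X X] by (auto simp: surj_isometry_def)
    define y where "y = inv_into X h (\<psi> (h z))"
    have y: "y \<in> X" "h y = \<psi> (h z)"
      using hb \<psi>hz by (auto simp: y_def bij_betw_inv_into_right bij_betw_def inv_into_into)
    have "k z - z = z - y"
      by (simp add: k_def y_def \<psi>_def z2 scaleR_2)
    then have "N (k z - z) = N (h z - h y)"
      using hs(1) zX y(1) by (simp add: surj_isometry_def isometric_on_def)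
    also have "h z - h y = 2 *\<^sub>R (h z - z)"
      using y(2) by (simp add: \<psi>_def z2 scaleR_2 algebra_simps)
    finally have "N (k z - z) = 2 * N (h z - z)"
      by (simp add: scaleR)
    then show ?thesis
      using cSUP_upper[OF k bdd] by (simp add: L_def)
  qed
  have gG: "g \<in> G"
    using g by (simp add: G_def)
  have "L \<le> L / 2"
    unfolding L_def
  proof (rule cSUP_least)
    show "G \<noteq> {}" using gG by auto
    show "N (h z - z) \<le> (SUP g\<in>G. N (g z - z)) / 2" if "h \<in> G" for h
      using double[OF that] by (simp add: L_def)
  qed
  then have "N (g z - z) \<le> 0"
    using double[OF gG] nonneg[of "g z - z"] by simp
  then have "g z = z"
    using nonneg[of "g z - z"] diff_eq_0_iff[of "g z" z] by simp
  then show ?thesis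
    by (simp add: z_def)
qed

text \<open>
  Conjugating the reflection in the midpoint of \<open>f a\<close> and \<open>f b\<close> by \<open>f\<close>, and composing with the
  reflection in the midpoint of \<open>a\<close> and \<open>b\<close>, gives an isometry that fixes \<open>a\<close> and \<open>b\<close>. That it also
  fixes their midpoint says that \<open>f\<close> respects midpoints.
\<close>

lemma surj_isometry_midpoint:
  assumes X: "subspace X" and ab: "a \<in> X" "b \<in> X" and f: "surj_isometry X f"
  shows "f ((1/2) *\<^sub>R (a + b)) = (1/2) *\<^sub>R (f a + f b)"
proof -
  define z where "z = (1/2) *\<^sub>R (a + b)"
  define h where "h = (\<lambda>x. a + b - x) \<circ> (inv_into X f \<circ> ((\<lambda>x. f a + f b - x) \<circ> f))"
  have fb: "bij_betw f X X"
    using f by (simp add: surj_isometry_def)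
  have fX: "f x \<in> X" if "x \<in> X" for x
    using bij_betwE[OF fb] that by auto
  have zX: "z \<in> X"
    using X ab by (auto simp: z_def intro: subspace_scale subspace_add)
  have "surj_isometry X h"
    unfolding h_def using X ab fX
    by (intro surj_isometry_comp surj_isometry_inv_into f surj_isometry_reflection subspace_add)
  moreover have "h a = a" "h b = b"
    using ab fb by (auto simp: h_def bij_betw_def)
  ultimately have "h z = z"
    unfolding z_def using X ab by (intro midpoint_fixed)
  then have "inv_into X f (f a + f b - f z) = a + b - z"
    by (simp add: h_def algebra_simps)
  also have "a + b - z = z"
    using scaleR_half_double[of "a + b"] by (simp add: z_def algebra_simps flip: scaleR_2)
  finally have "f a + f b - f z = f z"
    using fb fX ab zX X
    by (metis bij_betw_inv_into_right subspace_add subspace_diff)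
  then have "f a + f b = 2 *\<^sub>R f z"
    by (simp add: scaleR_2 algebra_simps)
  then show ?thesis
    by (simp add: z_def)
qed

text \<open>
  Respecting midpoints and fixing \<open>0\<close> means being additive. Homogeneity follows by boundedness: the
  defect \<open>g s = f (s x) - s f x\<close> is additive in \<open>s\<close> and vanishes on the integers, so it is periodic
  and bounded, and a bounded additive function is zero.
\<close>

theorem Mazur_Ulam:
  assumes X: "subspace X" and f: "surj_isometry X f" and f0: "f 0 = 0"
  shows "linear_isometry_on X N f"
proof -
  have fX: "f x \<in> X" if "x \<in> X" for x
    using f bij_betwE[of f X X] that by (auto simp: surj_isometry_def)
  have iso: "N (f x - f y) = N (x - y)" if "x \<in> X" "y \<in> X" for x y
    using f that by (simp add: surj_isometry_def isometric_on_def)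
  have 0: "0 \<in> X"
    using X by (rule subspace_0)
  have half: "f ((1/2) *\<^sub>R x) = (1/2) *\<^sub>R f x" if "x \<in> X" for x
    using surj_isometry_midpoint[OF X that 0 f] f0 by simp
  have add: "f (x + y) = f x + f y" if "x \<in> X" "y \<in> X" for x y
  proof -
    have "(1/2) *\<^sub>R f (x + y) = (1/2) *\<^sub>R (f x + f y)"
      using surj_isometry_midpoint[OF X that f] half[of "x + y"] X that by (simp add: subspace_add)
    then show ?thesis
      by simp
  qed
  have scale: "f (r *\<^sub>R x) = r *\<^sub>R f x" if x: "x \<in> X" for r x
  proof -
    define g where "g = (\<lambda>s. f (s *\<^sub>R x) - s *\<^sub>R f x)"
    have sX: "s *\<^sub>R x \<in> X" for s
      using X x by (rule subspace_scale)
    have g_add: "g (s + t) = g s + g t" for s t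
      using add[OF sX[of s] sX[of t]] by (simp add: g_def algebra_simps)
    have g0: "g 0 = 0"
      by (simp add: g_def f0)
    have g_nat: "g (of_nat n * s) = of_nat n *\<^sub>R g s" for n s
      by (induction n) (simp_all add: g0 g_add algebra_simps)
    have g_minus: "g (- s) = - g s" for s
      using g_add[of s "-s"] g0 by (simp add: eq_neg_iff_add_eq_0 add.commute)
    have g1: "g 1 = 0"
      by (simp add: g_def)
    have g_int: "g (of_int k) = 0" for k
    proof (cases k)
      case (nonneg n)
      then show ?thesis
        using g_nat[of n 1] by (simp add: g1)
    next
      case (neg n)
      then show ?thesis
        using g_nat[of "Suc n" 1] g_minus[of "of_nat (Suc n)"] by (simp add: g1)
    qed
    have Nf: "N (f y) = N y" if "y \<in> X" for y
      using iso[OF that 0] f0 by simp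
    have g_small: "N (g s) \<le> 2 * \<bar>s\<bar> * N x" for s
      using triangle[of "f (s *\<^sub>R x)" "- (s *\<^sub>R f x)"]
      by (simp add: g_def minus scaleR Nf x sX)
    have g_bounded: "N (g s) \<le> 2 * N x" for s
    proof -
      have "g s = g (frac s)"
        using g_add[of "of_int \<lfloor>s\<rfloor>" "frac s"] g_int[of "\<lfloor>s\<rfloor>"] by (simp add: frac_def)
      moreover have "2 * \<bar>frac s\<bar> * N x \<le> 2 * 1 * N x"
        using frac_lt_1[of s] nonneg[of x] by (intro mult_right_mono) auto
      ultimately show ?thesis
        using g_small[of "frac s"] by simp
    qed
    have "N (g r) = 0"
    proof (rule ccontr)
      assume "N (g r) \<noteq> 0"
      then have "N (g r) > 0"
        using nonneg[of "g r"] by simp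
      then obtain n :: nat where "2 * N x < of_nat n * N (g r)"
        using reals_Archimedean3 by blast
      then show False
        using g_bounded[of "of_nat n * r"] by (simp add: g_nat scaleR)
    qed
    then show ?thesis
      by (simp add: g_def eq_0_iff)
  qed
  show ?thesis
    unfolding linear_isometry_on_def using fX add scale iso by auto
qed

end

locale finite_dim_norm = real_norm N for N :: "'v::euclidean_space \<Rightarrow> real"
begin

lemma bounded_by_norm: "\<exists>C>0. \<forall>x. N x \<le> C * norm x"
proof -
  have fin: "N (sum f S) \<le> (\<Sum>i\<in>S. N (f i))" if "finite S" for f and S :: "'v set"
    using that
  proof induction
    case (insert i S)
    then show ?case
      using triangle[of "f i" "sum f S"] by simp
  qed (simp add: zero)
  have "N x \<le> (\<Sum>b\<in>Basis. N b) * norm x" for x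
  proof -
    have "N x = N (\<Sum>b\<in>Basis. (x \<bullet> b) *\<^sub>R b)"
      by (simp add: euclidean_representation)
    also have "\<dots> \<le> (\<Sum>b\<in>Basis. N ((x \<bullet> b) *\<^sub>R b))"
      by (rule fin) simp
    also have "\<dots> \<le> (\<Sum>b\<in>Basis. N b * norm x)"
      by (intro sum_mono) (auto simp: scaleR mult.commute intro!: mult_left_mono Basis_le_norm nonneg)
    finally show ?thesis
      by (simp add: sum_distrib_right)
  qed
  moreover have "norm x * (\<Sum>b\<in>Basis. N b) \<le> norm x * (1 + (\<Sum>b\<in>Basis. N b))" for x :: 'v
    by (intro mult_left_mono) auto
  ultimately have "N x \<le> (1 + (\<Sum>b\<in>Basis. N b)) * norm x" for x
    by (metis mult.commute order_trans)
  moreover have "1 + (\<Sum>b\<in>Basis. N b) > 0"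
    by (intro add_pos_nonneg sum_nonneg) (auto simp: nonneg)
  ultimately show ?thesis
    by blast
qed

lemma continuous_on_N: "continuous_on S N"
proof -
  obtain C where C: "C > 0" "\<And>x. N x \<le> C * norm x"
    using bounded_by_norm by blast
  have "dist (N x) (N y) \<le> C * dist x y" for x y
  proof -
    have "\<bar>N x - N y\<bar> \<le> N (x - y)"
      using triangle[of "x - y" y] triangle[of "y - x" x] minus_commute[of x y] by auto
    then show ?thesis
      using C(2)[of "x - y"] by (simp add: dist_norm)
  qed
  then have "C-lipschitz_on S N"
    using C(1) by (intro lipschitz_onI) auto
  then show ?thesis
    by (rule lipschitz_on_continuous_on)
qed

text \<open>The best constant comes from the minimum of \<open>N\<close> on the compact Euclidean unit sphere.\<close>

lemma norm_bounded: "\<exists>C>0. \<forall>x. norm x \<le> C * N x"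
proof -
  have "compact (sphere (0::'v) 1)" "sphere (0::'v) 1 \<noteq> {}"
    by simp_all
  then obtain p where p: "p \<in> sphere 0 1" "\<And>x. x \<in> sphere 0 1 \<Longrightarrow> N p \<le> N x"
    using continuous_attains_inf[OF _ _ continuous_on_N] by metis
  have "N p > 0"
    using p(1) nonneg[of p] eq_0_iff[of p] by (auto simp: less_le)
  have "norm x \<le> (1 / N p) * N x" for x
  proof (cases "x = 0")
    case False
    have "N p \<le> N ((1 / norm x) *\<^sub>R x)"
      using False by (intro p(2)) simp
    then show ?thesis
      using False \<open>N p > 0\<close> by (simp add: scaleR field_simps)
  qed (simp add: zero)
  then show ?thesis
    using \<open>N p > 0\<close> by (intro exI[of _ "1 / N p"]) auto
qed

lemma tendsto_N_imp_tendsto: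
  assumes "((\<lambda>s. N (f s - l)) \<longlongrightarrow> 0) F"
  shows "(f \<longlongrightarrow> l) F"
proof -
  obtain C where C: "\<And>x. norm x \<le> C * N x"
    using norm_bounded by blast
  have "((\<lambda>s. C * N (f s - l)) \<longlongrightarrow> 0) F"
    using tendsto_mult_left[OF assms, of C] by simp
  then have "((\<lambda>s. f s - l) \<longlongrightarrow> 0) F"
    by (rule Lim_null_comparison[rotated]) (simp add: C)
  then show ?thesis
    by (simp add: LIM_zero_iff)
qed

lemma isometric_continuous_on:
  assumes "isometric_on S f"
  shows "continuous_on S f"
  unfolding continuous_on_def
proof
  fix x assume x: "x \<in> S"
  have "isCont N (x - x)"
    using continuous_on_N[of UNIV] by (simp add: continuous_on_eq_continuous_at)
  then have "((\<lambda>y. N (y - x)) \<longlongrightarrow> N (x - x)) (at x within S)"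
    by (rule isCont_tendsto_compose) (intro tendsto_intros)
  moreover have "eventually (\<lambda>y. N (y - x) = N (f y - f x)) (at x within S)"
    using assms x by (auto simp: eventually_at_filter isometric_on_def)
  ultimately have "((\<lambda>y. N (f y - f x)) \<longlongrightarrow> 0) (at x within S)"
    by (auto simp: zero elim: Lim_transform_eventually)
  then show "(f \<longlongrightarrow> f x) (at x within S)"
    by (rule tendsto_N_imp_tendsto)
qed

text \<open>
  An isometry \<open>f\<close> fixing \<open>0\<close> maps the compact ball \<open>K\<close> of radius \<open>N y\<close> into itself. If \<open>y\<close> had
  positive distance \<open>\<delta>\<close> from the compact set \<open>f ` K\<close>, the orbit of \<open>y\<close> would satisfy
  \<open>N (f\<^sup>m\<^sup>+\<^sup>k y - f\<^sup>m y) = N (f\<^sup>k y - y) \<ge> \<delta>\<close> for all \<open>k > 0\<close> and could have no convergent subsequence.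
\<close>

lemma isometry_surj:
  assumes X: "subspace X" and fX: "\<And>x. x \<in> X \<Longrightarrow> f x \<in> X"
    and f: "isometric_on X f" and f0: "f 0 = 0"
  shows "surj_isometry X f"
proof -
  have iso: "N (f x - f y) = N (x - y)" if "x \<in> X" "y \<in> X" for x y
    using f that by (simp add: isometric_on_def)
  have Nf: "N (f x) = N x" if "x \<in> X" for x
    using iso[OF that subspace_0[OF X]] f0 by simp
  have "y \<in> f ` X" if y: "y \<in> X" for y
  proof -
    define K where "K = X \<inter> {x. N x \<le> N y}"
    obtain C where C: "C > 0" "\<And>x. norm x \<le> C * N x"
      using norm_bounded by blast
    have "closed K"
      unfolding K_def
      by (intro closed_Int closed_subspace X closed_Collect_le continuous_on_N continuous_intros)
    moreover have "bounded K"
    proof (rule boundedI)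
      fix x assume "x \<in> K"
      then have "C * N x \<le> C * N y"
        using C(1) by (simp add: K_def)
      then show "norm x \<le> C * N y"
        using C(2)[of x] by simp
    qed
    ultimately have K: "compact K"
      by (simp add: compact_eq_bounded_closed)
    have "continuous_on K f"
      using isometric_continuous_on[of K f] f by (auto simp: isometric_on_def K_def)
    then have "closed (f ` K)"
      using K by (intro compact_imp_closed compact_continuous_image)
    have fK: "f x \<in> K" if "x \<in> K" for x
      using that fX Nf by (auto simp: K_def)
    define s where "s = (\<lambda>n. (f ^^ n) y)"
    have sK: "s n \<in> K" for n
      by (induction n) (use y fK in \<open>auto simp: s_def K_def\<close>)
    have shift: "N (s (m + k) - s m) = N (s k - y)" for m k
    proof (induction m)
      case (Suc m)
      have "s (Suc m + k) = f (s (m + k))" "s (Suc m) = f (s m)"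
        by (simp_all add: s_def)
      then show ?case
        using Suc iso sK by (simp add: K_def)
    qed (simp add: s_def)
    have "y \<in> closure (f ` K)"
      unfolding closure_approachable
    proof safe
      fix e :: real assume e: "e > 0"
      obtain l r where r: "strict_mono (r :: nat \<Rightarrow> nat)" "(s \<circ> r) \<longlonglongrightarrow> l"
        using K sK seq_compactE[OF compact_imp_seq_compact] by metis
      obtain D where D: "D > 0" "\<And>x. N x \<le> D * norm x"
        using bounded_by_norm by blast
      have "Cauchy (s \<circ> r)"
        using r(2) by (rule LIMSEQ_imp_Cauchy)
      (* C and D convert between the Euclidean norm, in which convergence is stated, and N, which is
         invariant under shifting along the orbit. *)
      moreover have "e / (C * D) > 0"
        using e C(1) D(1) by simp
      ultimately obtain M where M: "norm ((s \<circ> r) (Suc M) - (s \<circ> r) M) < e / (C * D)"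
        unfolding Cauchy_iff by (metis le_refl le_SucI)
      (* The two orbit points have different indices, so their difference of indices is a successor
         and the corresponding iterate of y lies in the image of f. *)
      have less: "r M < r (Suc M)"
        using r(1) by (simp add: strict_mono_Suc_iff)
      then obtain k where k: "r (Suc M) = r M + Suc k"
        by (metis less_iff_Suc_add add_Suc_right)
      have "norm (s (Suc k) - y) \<le> C * N (s (Suc k) - y)"
        by (rule C(2))
      also have "\<dots> = C * N (s (r (Suc M)) - s (r M))"
        by (simp only: k shift)
      also have "\<dots> \<le> C * (D * norm (s (r (Suc M)) - s (r M)))"
        using C(1) D(2) by simp
      also have "\<dots> < e"
        using M C(1) D(1) by (simp add: field_simps)
      finally have "dist (f (s k)) y < e"
        by (simp add: dist_norm s_def)
      then show "\<exists>x\<in>f ` K. dist x y < e"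
        using sK by blast
    qed
    then show ?thesis
      using \<open>closed (f ` K)\<close> by (auto simp: K_def)
  qed
  moreover have "inj_on f X"
  proof (rule inj_onI)
    fix x y assume "x \<in> X" "y \<in> X" "f x = f y"
    then show "x = y"
      using iso[of x y] by (simp add: zero diff_eq_0_iff)
  qed
  ultimately show ?thesis
    using fX f by (auto simp: surj_isometry_def bij_betw_def)
qed

end


section \<open>The unitary group\<close>

lemma norm_conjugate: "norm (conjugate z) = norm (z :: 'a::real_or_complex)"
proof (cases "z = 0")
  case False
  have "norm z * norm (conjugate z) = (norm z)\<^sup>2"
    using arg_cong[OF mult_conjugate[of z], of norm] by (simp add: norm_mult norm_power)
  then show ?thesis
    using False by (simp add: power2_eq_square)
qed simp

lemma bounded_linear_conjugate: "bounded_linear (conjugate :: 'a::real_or_complex \<Rightarrow> 'a)"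
  by (rule bounded_linear_intro[where K = 1])
    (simp_all add: conjugate_dist_add conjugate_dist_mul conjugate_of_real_roc norm_conjugate
      scaleR_conv_of_real)

lemma conj_transpose_mult:
  "conj_transpose (a ** b) = conj_transpose b ** conj_transpose (a :: 'a::real_or_complex ^ 'n ^ 'n)"
  by (simp add: conj_transpose_def matrix_matrix_mult_def vec_eq_iff sum_conjugate conjugate_dist_mul
      mult.commute)

lemma conj_transpose_mat: "conj_transpose (mat c :: 'a::real_or_complex ^ 'n ^ 'n) = mat (conjugate c)"
  by (auto simp: conj_transpose_def mat_def vec_eq_iff)

lemma mat_mult_nth: "(mat c ** x) $ i $ j = c * (x :: 'a::comm_semiring_1 ^ 'n ^ 'm) $ i $ j"
  by (simp add: matrix_matrix_mult_def mat_def if_distrib[of "\<lambda>y. y * _"] cong: if_cong)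

lemma mult_mat_nth: "(x ** mat c) $ i $ j = c * (x :: 'a::comm_semiring_1 ^ 'n ^ 'm) $ i $ j"
  by (simp add: matrix_matrix_mult_def mat_def if_distrib[of "\<lambda>y. _ * y"] mult.commute cong: if_cong)

lemma mat_commute: "mat c ** x = (x :: 'a::comm_semiring_1 ^ 'n ^ 'm) ** mat c"
  by (simp add: vec_eq_iff mat_mult_nth mult_mat_nth)

lemma mat_mult_mat: "mat c ** mat d = (mat (c * d) :: 'a::comm_semiring_1 ^ 'n ^ 'n)"
  by (simp add: vec_eq_iff mat_mult_nth) (simp add: mat_def)

lemma tendsto_matrix_mult:
  fixes f g :: "'b \<Rightarrow> 'a::real_normed_field ^ 'n ^ 'n"
  assumes "(f \<longlongrightarrow> a) F" "(g \<longlongrightarrow> b) F"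
  shows "((\<lambda>x. f x ** g x) \<longlongrightarrow> a ** b) F"
  unfolding matrix_matrix_mult_def
  by (intro vec_tendstoI) (auto intro!: tendsto_intros tendsto_vec_nth assms)

lemma tendsto_conj_transpose:
  fixes f :: "'b \<Rightarrow> 'a::real_or_complex ^ 'n ^ 'n"
  assumes "(f \<longlongrightarrow> a) F"
  shows "((\<lambda>x. conj_transpose (f x)) \<longlongrightarrow> conj_transpose a) F"
  unfolding conj_transpose_def
proof (intro vec_tendstoI)
  show "((\<lambda>x. (\<chi> i j. conjugate (f x $ j $ i)) $ i $ j) \<longlongrightarrow> (\<chi> i j. conjugate (a $ j $ i)) $ i $ j) F" for i j
    using bounded_linear.tendsto[OF bounded_linear_conjugate tendsto_vec_nth[OF tendsto_vec_nth[OF assms]]]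
    by simp
qed

lemma unitary_matrices_iff:
  "u \<in> unitary_matrices \<longleftrightarrow> conj_transpose u ** u = mat 1 \<and> u ** conj_transpose u = mat 1"
  by (simp add: unitary_matrices_def)

lemma unitary_matrices_mult:
  assumes "u \<in> unitary_matrices" "w \<in> unitary_matrices"
  shows "u ** w \<in> unitary_matrices"
proof -
  have "conj_transpose (u ** w) ** (u ** w) = conj_transpose w ** (conj_transpose u ** u) ** w"
    by (simp add: conj_transpose_mult matrix_mul_assoc)
  moreover have "(u ** w) ** conj_transpose (u ** w) = u ** (w ** conj_transpose w) ** conj_transpose u"
    by (simp add: conj_transpose_mult matrix_mul_assoc)
  ultimately show ?thesis
    using assms by (simp add: unitary_matrices_iff)
qed

lemma mat_unitary_iff:
  "(mat c :: 'a::real_or_complex ^ 'n ^ 'n) \<in> unitary_matrices \<longleftrightarrow> norm c = 1"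
proof -
  have "(mat a :: 'a ^ 'n ^ 'n) = mat b \<longleftrightarrow> a = b" for a b
    by (auto simp: mat_def vec_eq_iff)
  moreover have "c * conjugate c = 1 \<longleftrightarrow> (norm c)\<^sup>2 = 1"
    unfolding mult_conjugate using of_real_eq_iff[of "(norm c)\<^sup>2" 1] by (metis of_real_1)
  ultimately show ?thesis
    by (simp add: unitary_matrices_iff conj_transpose_mat mat_mult_mat mult.commute power2_eq_1_iff
        del: of_real_power) (smt (verit) norm_ge_zero)
qed

text \<open>The rows of a unitary matrix are unit vectors.\<close>

lemma unitary_entry_bound:
  assumes "u \<in> unitary_matrices"
  shows "norm (u $ i $ j) \<le> 1"
proof -
  have "(\<Sum>k\<in>UNIV. of_real ((norm (u $ i $ k))\<^sup>2)) = (1 :: 'a)"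
  proof -
    have "(u ** conj_transpose u) $ i $ i = 1"
      using assms by (simp add: unitary_matrices_iff mat_def)
    then show ?thesis
      by (simp only: matrix_matrix_mult_def conj_transpose_def vec_lambda_beta mult_conjugate)
  qed
  then have "(\<Sum>k\<in>UNIV. (norm (u $ i $ k))\<^sup>2) = 1"
    by (metis of_real_eq_1_iff of_real_sum)
  moreover have "(norm (u $ i $ j))\<^sup>2 \<le> (\<Sum>k\<in>UNIV. (norm (u $ i $ k))\<^sup>2)"
    by (rule member_le_sum) auto
  ultimately show ?thesis
    by (simp add: power_le_one_iff abs_square_le_1)
qed

lemma compact_unitary_matrices: "compact (unitary_matrices :: ('a::real_or_complex ^ 'n ^ 'n) set)"
proof -
  have "bounded (unitary_matrices :: ('a ^ 'n ^ 'n) set)"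
  proof (rule boundedI)
    fix u :: "'a ^ 'n ^ 'n" assume u: "u \<in> unitary_matrices"
    have "norm (u $ i) \<le> real CARD('n)" for i
    proof -
      have "norm (u $ i) \<le> (\<Sum>j\<in>UNIV. norm (u $ i $ j))"
        unfolding norm_vec_def by (rule L2_set_le_sum) simp
      also have "\<dots> \<le> (\<Sum>j\<in>(UNIV :: 'n set). 1)"
        by (intro sum_mono unitary_entry_bound u)
      finally show ?thesis
        by simp
    qed
    moreover have "norm u \<le> (\<Sum>i\<in>UNIV. norm (u $ i))"
      unfolding norm_vec_def[of u] by (rule L2_set_le_sum) simp
    ultimately show "norm u \<le> (\<Sum>i\<in>(UNIV :: 'n set). real CARD('n))"
      by (meson order_trans sum_mono)
  qed
  moreover have "closed (unitary_matrices :: ('a ^ 'n ^ 'n) set)"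
  proof -
    have "continuous_on UNIV (\<lambda>u :: 'a ^ 'n ^ 'n. conj_transpose u ** u)"
      "continuous_on UNIV (\<lambda>u :: 'a ^ 'n ^ 'n. u ** conj_transpose u)"
      unfolding continuous_on_def
      by (auto intro!: tendsto_matrix_mult tendsto_conj_transpose tendsto_ident_at)
    then show ?thesis
      unfolding unitary_matrices_def
      by (intro closed_Collect_conj closed_Collect_eq continuous_on_const)
  qed
  ultimately show ?thesis
    by (simp add: compact_eq_bounded_closed)
qed

section \<open>Twisted representations close to the identity\<close>

text \<open>
  Only the \<open>u k\<close> need a compactness argument: since \<open>\<gamma>\<close> fixes the identity matrix,
  \<open>w k = (u k)\<^sup>* (u k \<gamma>(I) w k)\<close> converges to \<open>v\<^sup>*\<close> whenever \<open>u k\<close> converges to \<open>v\<close>. The limiting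
  identity puts \<open>v\<close> in the \<open>\<gamma>\<close>-commutant of \<open>X\<close>, which consists of scalars.
\<close>

lemma twisted_representation_limit:
  fixes X :: "('a::real_or_complex ^ 'n ^ 'n) set" and u w :: "nat \<Rightarrow> 'a ^ 'n ^ 'n"
  assumes large: "large \<Gamma> X" and \<gamma>: "\<gamma> \<in> \<Gamma>" "\<gamma> (mat 1) = mat 1"
    and u: "\<And>k. u k \<in> unitary_matrices" and w: "\<And>k. w k \<in> unitary_matrices"
    and lim: "\<And>x. x \<in> X \<Longrightarrow> (\<lambda>k. u k ** \<gamma> x ** w k) \<longlonglongrightarrow> x"
  obtains r c where "strict_mono (r :: nat \<Rightarrow> nat)" "norm c = 1" "(u \<circ> r) \<longlonglongrightarrow> mat c"
    "\<And>x. x \<in> X \<Longrightarrow> \<gamma> x = x"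
proof -
  obtain v r where v: "v \<in> unitary_matrices" and r: "strict_mono (r :: nat \<Rightarrow> nat)"
    and ur: "(u \<circ> r) \<longlonglongrightarrow> v"
    using seq_compactE[OF compact_imp_seq_compact[OF compact_unitary_matrices]] u by metis
  have ur': "(\<lambda>k. u (r k)) \<longlonglongrightarrow> v"
    using ur by (simp add: o_def)
  have I: "mat 1 \<in> X"
    using large by (simp add: large_def)
  have sub: "(\<lambda>k. u (r k) ** \<gamma> x ** w (r k)) \<longlonglongrightarrow> x" if "x \<in> X" for x
    using LIMSEQ_subseq_LIMSEQ[OF lim[OF that] r] by (simp add: o_def)
  have w_eq: "conj_transpose (u k) ** (u k ** \<gamma> (mat 1) ** w k) = w k" for k
    using u[of k] by (simp add: \<gamma> matrix_mul_assoc unitary_matrices_iff)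
  have "(\<lambda>k. conj_transpose (u (r k)) ** (u (r k) ** \<gamma> (mat 1) ** w (r k)))
      \<longlonglongrightarrow> conj_transpose v ** mat 1"
    by (intro tendsto_matrix_mult tendsto_conj_transpose ur' sub I)
  then have wr: "(\<lambda>k. w (r k)) \<longlonglongrightarrow> conj_transpose v"
    by (simp only: w_eq matrix_mul_rid)
  have rep: "x = v ** \<gamma> x ** conj_transpose v" if "x \<in> X" for x
    by (rule LIMSEQ_unique[OF sub[OF that]]) (intro tendsto_matrix_mult ur' wr tendsto_const)
  have comm: "x ** v = v ** \<gamma> x" if "x \<in> X" for x
  proof -
    have "x ** v = v ** \<gamma> x ** (conj_transpose v ** v)"
      using rep[OF that] by (metis matrix_mul_assoc)
    then show ?thesis
      using v by (simp add: unitary_matrices_iff)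
  qed
  then have "v \<in> twisted_commutant X \<gamma>"
    by (simp add: twisted_commutant_def)
  then obtain c where c: "v = mat c"
    using large \<gamma>(1) unfolding large_def by blast
  have "\<gamma> x = x" if "x \<in> X" for x
  proof -
    have "\<gamma> x = conj_transpose v ** (v ** \<gamma> x)"
      using v by (simp add: matrix_mul_assoc unitary_matrices_iff)
    also have "\<dots> = conj_transpose v ** (v ** x)"
      using comm[OF that] by (simp add: c mat_commute)
    also have "\<dots> = x"
      using v by (simp add: matrix_mul_assoc unitary_matrices_iff)
    finally show ?thesis .
  qed
  then show ?thesis
    using that[of r c] r ur v by (simp add: c mat_unitary_iff)
qed

text \<open>
  A representation \<open>x \<mapsto> u x w\<close> determines \<open>u\<close> at best up to a scalar of modulus 1. Making the
  \<open>(i, i)\<close> entry of \<open>u\<close> nonnegative selects one candidate as soon as this entry is nonzero, which is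
  the case for \<open>u\<close> close to a scalar unitary matrix.
\<close>

lemma phase_normalization:
  fixes u w :: "'a::real_or_complex ^ 'n ^ 'n"
  assumes "u \<in> unitary_matrices" "w \<in> unitary_matrices"
  obtains u' w' where "u' \<in> unitary_matrices" "w' \<in> unitary_matrices"
    "\<And>x. u' ** x ** w' = u ** x ** w" "u' $ i $ i = of_real (norm (u' $ i $ i))"
proof -
  define z where "z = u $ i $ i"
  define c where "c = (if z = 0 then 1 else of_real (norm z) / z)"
  have c: "norm c = 1" "c * z = of_real (norm z)" "c \<noteq> 0"
    by (auto simp: c_def norm_divide)
  have "mat c ** u \<in> unitary_matrices" "w ** mat (inverse c) \<in> unitary_matrices"
    using assms c by (auto intro!: unitary_matrices_mult simp: mat_unitary_iff norm_inverse)
  moreover have "(mat c ** u) ** x ** (w ** mat (inverse c)) = u ** x ** w" for x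
  proof -
    have "(mat c ** u) ** x ** (w ** mat (inverse c)) = mat c ** (u ** x ** w ** mat (inverse c))"
      by (simp add: matrix_mul_assoc)
    also have "\<dots> = mat c ** mat (inverse c) ** (u ** x ** w)"
      by (simp add: mat_commute[of "inverse c", symmetric] matrix_mul_assoc)
    finally show ?thesis
      using c by (simp add: mat_mult_mat)
  qed
  moreover have "(mat c ** u) $ i $ i = of_real (norm ((mat c ** u) $ i $ i))"
    using c by (simp add: mat_mult_nth norm_mult flip: z_def)
  ultimately show ?thesis
    by (rule that)
qed

lemma frequently_at_within_sequence:
  fixes a :: "'a::metric_space"
  assumes "frequently P (at a within S)"
  obtains f :: "nat \<Rightarrow> 'a" where "\<And>n. f n \<in> S" "\<And>n. P (f n)" "\<And>n. f n \<noteq> a" "f \<longlonglongrightarrow> a"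
proof -
  have "\<exists>x\<in>S. x \<noteq> a \<and> dist x a < inverse (real (Suc n)) \<and> P x" for n
    using assms unfolding frequently_at by simp
  then obtain f where f: "\<And>n. f n \<in> S" "\<And>n. f n \<noteq> a" "\<And>n. P (f n)"
    "\<And>n. dist (f n) a < inverse (real (Suc n))"
    by metis
  have "(\<lambda>n. dist (f n) a) \<longlonglongrightarrow> 0"
    by (rule Lim_null_comparison[OF _ LIMSEQ_inverse_real_of_nat]) (use less_imp_le[OF f(4)] in simp)
  then show ?thesis
    using that[of f] f tendsto_dist_iff[THEN iffD2, of f a] by blast
qed

text \<open>
  If some \<open>\<gamma>\<close> that is not the identity on \<open>X\<close> represented \<open>A t\<close> for \<open>t\<close> arbitrarily close to \<open>a\<close>,
  then \<open>twisted_representation_limit\<close> would show that it is the identity on \<open>X\<close>. Finiteness of \<open>\<Gamma>\<close>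
  gives one neighbourhood that works for all \<open>\<gamma>\<close> simultaneously.
\<close>

lemma eventually_untwisted:
  fixes X :: "('a::real_or_complex ^ 'n ^ 'n) set" and A :: "'b::metric_space \<Rightarrow> _"
  assumes \<Gamma>: "test_set \<Gamma>" "large \<Gamma> X"
    and rep: "\<And>t. t \<in> S \<Longrightarrow>
      \<exists>u\<in>unitary_matrices. \<exists>w\<in>unitary_matrices. \<exists>\<gamma>\<in>\<Gamma>. \<forall>x\<in>X. A t x = u ** \<gamma> x ** w"
    and lim: "\<And>x. x \<in> X \<Longrightarrow> ((\<lambda>t. A t x) \<longlongrightarrow> x) (at a within S)"
  shows "eventually (\<lambda>t. \<exists>u\<in>unitary_matrices. \<exists>w\<in>unitary_matrices. \<forall>x\<in>X. A t x = u ** x ** w)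
    (at a within S)"
proof -
  define P where "P = (\<lambda>\<gamma> t. \<exists>u\<in>unitary_matrices. \<exists>w\<in>unitary_matrices. \<forall>x\<in>X. A t x = u ** \<gamma> x ** w)"
  have "eventually (\<lambda>t. P \<gamma> t \<longrightarrow> (\<forall>x\<in>X. \<gamma> x = x)) (at a within S)" if \<gamma>: "\<gamma> \<in> \<Gamma>" for \<gamma>
  proof (rule ccontr)
    assume "\<not> ?thesis"
    then have "frequently (\<lambda>t. P \<gamma> t \<and> \<not> (\<forall>x\<in>X. \<gamma> x = x)) (at a within S)"
      by (simp add: frequently_def)
    then obtain t where t: "\<And>n. t n \<in> S" "\<And>n. P \<gamma> (t n) \<and> \<not> (\<forall>x\<in>X. \<gamma> x = x)"
      "\<And>n. t n \<noteq> a" "(t :: nat \<Rightarrow> 'b) \<longlonglongrightarrow> a"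
      using frequently_at_within_sequence by blast
    have "\<exists>u w. u \<in> unitary_matrices \<and> w \<in> unitary_matrices \<and>
        (\<forall>x\<in>X. A (t n) x = u ** \<gamma> x ** w)" for n
      using t(2)[of n] unfolding P_def by blast
    then obtain u w where uw: "\<And>n. u n \<in> unitary_matrices" "\<And>n. w n \<in> unitary_matrices"
      "\<And>n x. x \<in> X \<Longrightarrow> A (t n) x = u n ** \<gamma> x ** w n"
      by metis
    have "filterlim t (at a within S) sequentially"
      using t by (simp add: filterlim_at)
    then have A_lim: "(\<lambda>n. A (t n) x) \<longlonglongrightarrow> x" if "x \<in> X" for x
      using lim[OF that] by (rule filterlim_compose[rotated])
    have uw_lim: "(\<lambda>n. u n ** \<gamma> x ** w n) \<longlonglongrightarrow> x" if "x \<in> X" for x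
      using A_lim[OF that] by (simp only: uw(3)[OF that])
    have "\<gamma> (mat 1) = mat 1"
      using \<Gamma>(1) \<gamma> by (simp add: test_set_def)
    then have "\<forall>x\<in>X. \<gamma> x = x"
      using twisted_representation_limit[OF \<Gamma>(2) \<gamma> _ uw(1,2) uw_lim] by blast
    then show False
      using t(2) by blast
  qed
  then have "eventually (\<lambda>t. \<forall>\<gamma>\<in>\<Gamma>. P \<gamma> t \<longrightarrow> (\<forall>x\<in>X. \<gamma> x = x)) (at a within S)"
    using \<Gamma>(1) by (intro eventually_ball_finite) (auto simp: test_set_def)
  moreover have "eventually (\<lambda>t. t \<in> S) (at a within S)"
    by (simp add: eventually_at_filter)
  ultimately show ?thesis
  proof eventually_elim
    case (elim t)
    from rep[OF elim(2)] obtain u w \<gamma> where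
      *: "u \<in> unitary_matrices" "w \<in> unitary_matrices" "\<gamma> \<in> \<Gamma>" "\<forall>x\<in>X. A t x = u ** \<gamma> x ** w"
      by blast
    then have "\<forall>x\<in>X. \<gamma> x = x"
      using elim(1) unfolding P_def by blast
    then show ?case
      using * by auto
  qed
qed

text \<open>
  Every sequence of parameters tending to \<open>a\<close> has a subsequence along which \<open>u\<close> tends to a scalar
  \<open>c\<close> of modulus 1. The normalization passes to the limit as \<open>c = |c|\<close>, so \<open>c = 1\<close>.
\<close>

lemma normalized_representation_tendsto:
  fixes X :: "('a::real_or_complex ^ 'n ^ 'n) set" and u w :: "'b::metric_space \<Rightarrow> 'a ^ 'n ^ 'n"
  assumes \<Gamma>: "test_set \<Gamma>" "large \<Gamma> X"
    and u: "\<And>t. t \<in> S \<Longrightarrow> u t \<in> unitary_matrices" and w: "\<And>t. t \<in> S \<Longrightarrow> w t \<in> unitary_matrices"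
    and normalized: "\<And>t. t \<in> S \<Longrightarrow> u t $ i $ i = of_real (norm (u t $ i $ i))"
    and lim: "\<And>x. x \<in> X \<Longrightarrow> ((\<lambda>t. u t ** x ** w t) \<longlongrightarrow> x) (at a within S)"
  shows "(u \<longlongrightarrow> mat 1) (at a within S)" "(w \<longlongrightarrow> mat 1) (at a within S)"
proof -
  show u_lim: "(u \<longlongrightarrow> mat 1) (at a within S)"
  proof (rule tendstoI, rule ccontr)
    fix e :: real assume e: "e > 0" and "\<not> eventually (\<lambda>t. dist (u t) (mat 1) < e) (at a within S)"
    then have "frequently (\<lambda>t. dist (u t) (mat 1) \<ge> e) (at a within S)"
      by (simp add: frequently_def not_le)
    then obtain t where t: "\<And>n. t n \<in> S" "\<And>n. dist (u (t n)) (mat 1) \<ge> e"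
      "\<And>n. t n \<noteq> a" "(t :: nat \<Rightarrow> 'b) \<longlonglongrightarrow> a"
      by (rule frequently_at_within_sequence) blast
    have "filterlim t (at a within S) sequentially"
      using t by (simp add: filterlim_at)
    then have uw_lim: "(\<lambda>n. u (t n) ** id x ** w (t n)) \<longlonglongrightarrow> x" if "x \<in> X" for x
      using filterlim_compose[OF lim[OF that]] by simp
    have "id \<in> \<Gamma>"
      using \<Gamma>(1) by (simp add: test_set_def)
    then obtain r c where rc: "strict_mono (r :: nat \<Rightarrow> nat)" "norm c = 1"
      "((\<lambda>n. u (t n)) \<circ> r) \<longlonglongrightarrow> mat c"
      by (rule twisted_representation_limit[OF \<Gamma>(2) _ id_apply u[OF t(1)] w[OF t(1)] uw_lim])
    have entry: "(\<lambda>n. u (t (r n)) $ i $ i) \<longlonglongrightarrow> c"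
      using tendsto_vec_nth[OF tendsto_vec_nth[OF rc(3)], of i i] by (simp add: o_def mat_def)
    have "(\<lambda>n. of_real (norm (u (t (r n)) $ i $ i)) :: 'a) \<longlonglongrightarrow> of_real (norm c)"
      by (intro tendsto_of_real tendsto_norm entry)
    then have "(\<lambda>n. u (t (r n)) $ i $ i) \<longlonglongrightarrow> of_real (norm c)"
      by (simp only: normalized[OF t(1), symmetric])
    then have "c = 1"
      using LIMSEQ_unique[OF entry] rc(2) by simp
    then have "(\<lambda>n. dist (u (t (r n))) (mat 1)) \<longlonglongrightarrow> 0"
      using rc(3)[THEN tendsto_dist_iff[THEN iffD1]] by (simp add: o_def)
    then have "eventually (\<lambda>n. dist (u (t (r n))) (mat 1) < e) sequentially"
      using e by (rule order_tendstoD)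
    then show False
      using t(2) by (auto simp: eventually_sequentially not_less[symmetric])
  qed
  have "mat 1 \<in> X"
    using \<Gamma>(2) by (simp add: large_def)
  then have "((\<lambda>t. conj_transpose (u t) ** (u t ** mat 1 ** w t)) \<longlongrightarrow> conj_transpose (mat 1) ** mat 1)
      (at a within S)"
    by (intro tendsto_matrix_mult tendsto_conj_transpose u_lim lim)
  moreover have "eventually (\<lambda>t. conj_transpose (u t) ** (u t ** mat 1 ** w t) = w t) (at a within S)"
    using u by (auto simp: eventually_at_filter matrix_mul_assoc unitary_matrices_iff)
  moreover have "conj_transpose (mat 1 :: 'a ^ 'n ^ 'n) = mat 1"
    using conjugate_of_real_roc[of 1, where ?'a = 'a] by (simp add: conj_transpose_mat)
  ultimately show "(w \<longlongrightarrow> mat 1) (at a within S)"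
    by (auto dest: Lim_transform_eventually)
qed

section \<open>Rigid motions\<close>

lemma is_matrix_norm_imp_finite_dim_norm:
  assumes "is_matrix_norm N"
  shows "finite_dim_norm (N :: 'a::real_or_complex ^ 'n ^ 'n \<Rightarrow> real)"
proof
  show "N (r *\<^sub>R x) = \<bar>r\<bar> * N x" for r x
  proof -
    have "r *\<^sub>R x = scalar_mult (of_real r) x"
      unfolding scalar_mult_def by (simp add: vec_eq_iff scaleR_conv_of_real[of r "_ :: 'a"])
    then show ?thesis
      using assms by (simp add: is_matrix_norm_def)
  qed
qed (use assms in \<open>auto simp: is_matrix_norm_def\<close>)

lemma (in real_norm) path_differentiable_at_subset:
  assumes "path_differentiable_at X N S f t" "T \<subseteq> S"
  shows "path_differentiable_at X N T f t"
  using assms unfolding path_differentiable_at_def by (meson tendsto_within_subset)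

lemma (in real_norm) path_differentiable_at_diff:
  assumes X: "subspace X" and f: "path_differentiable_at X N S f t" and g: "path_differentiable_at X N S g t"
  shows "path_differentiable_at X N S (\<lambda>s. f s - g s) t"
proof -
  obtain d e where d: "d \<in> X" "((\<lambda>s. N ((f s - f t) /\<^sub>R (s - t) - d)) \<longlongrightarrow> 0) (at t within S)"
    and e: "e \<in> X" "((\<lambda>s. N ((g s - g t) /\<^sub>R (s - t) - e)) \<longlongrightarrow> 0) (at t within S)"
    using f g unfolding path_differentiable_at_def by blast
  have bound: "N (((f s - g s) - (f t - g t)) /\<^sub>R (s - t) - (d - e)) \<le>
      N ((f s - f t) /\<^sub>R (s - t) - d) + N ((g s - g t) /\<^sub>R (s - t) - e)" for s
  proof -
    have "((f s - g s) - (f t - g t)) /\<^sub>R (s - t) - (d - e) =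
        ((f s - f t) /\<^sub>R (s - t) - d) + - ((g s - g t) /\<^sub>R (s - t) - e)"
      by (simp add: algebra_simps)
    then show ?thesis
      by (metis triangle minus)
  qed
  have lim: "((\<lambda>s. N ((f s - f t) /\<^sub>R (s - t) - d) + N ((g s - g t) /\<^sub>R (s - t) - e)) \<longlongrightarrow> 0)
      (at t within S)"
    using tendsto_add[OF d(2) e(2)] by simp
  have "((\<lambda>s. N (((f s - g s) - (f t - g t)) /\<^sub>R (s - t) - (d - e))) \<longlongrightarrow> 0) (at t within S)"
    by (rule Lim_null_comparison[OF _ lim]) (use bound in \<open>auto simp: nonneg\<close>)
  then show ?thesis
    unfolding path_differentiable_at_def using subspace_diff[OF X d(1) e(1)] by blast
qed

lemma path_differentiable_at_cong:
  assumes "path_differentiable_at X N S f t" "\<And>s. s \<in> S \<Longrightarrow> f s = g s" "t \<in> S"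
  shows "path_differentiable_at X N S g t"
proof -
  obtain d where "d \<in> X" "((\<lambda>s. N ((f s - f t) /\<^sub>R (s - t) - d)) \<longlongrightarrow> 0) (at t within S)"
    using assms(1) unfolding path_differentiable_at_def by blast
  moreover from this(2) have "((\<lambda>s. N ((g s - g t) /\<^sub>R (s - t) - d)) \<longlongrightarrow> 0) (at t within S)"
    by (rule Lim_transform_eventually) (use assms(2,3) in \<open>auto simp: eventually_at_filter\<close>)
  ultimately show ?thesis
    unfolding path_differentiable_at_def by blast
qed

theorem proposition2p11:
  fixes X :: "('a::real_or_complex ^ 'n ^ 'n) set"
    and N :: "'a ^ 'n ^ 'n \<Rightarrow> real"
    and i\<^sub>1 :: 'n
    and \<alpha> :: "'a ^ 'n ^ 'n \<Rightarrow> real \<Rightarrow> 'a ^ 'n ^ 'n"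
  assumes "CARD('n) \<ge> 2"
    and "admissible_matrix_space i\<^sub>1 X N"
    and "\<alpha> \<in> rigid_motions X N"
  shows "\<exists>(T :: real set) (u :: real \<Rightarrow> 'a ^ 'n ^ 'n) (w :: real \<Rightarrow> 'a ^ 'n ^ 'n) (c :: real \<Rightarrow> 'a ^ 'n ^ 'n).
    T \<subseteq> {-1..1} \<and> 0 \<in> interior T \<and>
    (\<forall>t\<in>T. u t \<in> unitary_matrices \<and> w t \<in> unitary_matrices \<and> c t \<in> X) \<and>
    (\<forall>x\<in>X. \<forall>t\<in>T. \<alpha> x t = u t ** x ** w t + c t) \<and>
    (c 0 = 0 \<and> u 0 = mat 1 \<and> w 0 = mat 1) \<and>
    (path_differentiable_at X N T c 0 \<and>
      (\<forall>x\<in>X. path_differentiable_at X N T (\<lambda>t. u t ** x ** w t) 0)) \<and>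
    (continuous (at 0 within T) u \<and> continuous (at 0 within T) w)"
proof -
  obtain \<Gamma> where X: "subspace X" and N: "unitarily_invariant_norm N"
    and \<Gamma>: "test_set \<Gamma>" "large \<Gamma> X" and iso: "isometry_property \<Gamma> X N"
    using assms(2) unfolding admissible_matrix_space_def by blast
  interpret finite_dim_norm N
    using N by (intro is_matrix_norm_imp_finite_dim_norm) (simp add: unitarily_invariant_norm_def)
  let ?J = "{-1..1::real}"
  have \<alpha>X: "\<alpha> x t \<in> X" if "x \<in> X" "t \<in> ?J" for x t
    using assms(3) that by (simp add: rigid_motions_def)
  have \<alpha>0: "\<alpha> x 0 = x" if "x \<in> X" for x
    using assms(3) that by (simp add: rigid_motions_def)
  have \<alpha>_iso: "N (\<alpha> x t - \<alpha> y t) = N (x - y)" if "x \<in> X" "y \<in> X" "t \<in> ?J" for x y t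
    using assms(3) that by (simp add: rigid_motions_def)
  have \<alpha>_diff: "path_differentiable_at X N ?J (\<alpha> x) 0" if "x \<in> X" for x
    using assms(3) that by (simp add: rigid_motions_def)
  have \<alpha>_lim: "(\<alpha> x \<longlongrightarrow> x) (at 0 within ?J)" if "x \<in> X" for x
  proof -
    have "path_continuous_on N ?J (\<alpha> x)"
      using assms(3) that by (simp add: rigid_motions_def)
    then have "((\<lambda>s. N (\<alpha> x s - x)) \<longlongrightarrow> 0) (at 0 within ?J)"
      using \<alpha>0[OF that] by (auto simp: path_continuous_on_def dest!: bspec[of _ _ 0])
    then show ?thesis
      by (rule tendsto_N_imp_tendsto)
  qed
  have 0: "0 \<in> X"
    using X by (rule subspace_0)
  define A where "A = (\<lambda>t x. \<alpha> x t - \<alpha> 0 t)"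
  have rep: "\<exists>u\<in>unitary_matrices. \<exists>w\<in>unitary_matrices. \<exists>\<gamma>\<in>\<Gamma>. \<forall>x\<in>X. A t x = u ** \<gamma> x ** w"
    if t: "t \<in> ?J" for t
  proof -
    have "surj_isometry X (A t)"
      by (rule isometry_surj)
        (use t X 0 \<alpha>X \<alpha>_iso in \<open>auto simp: A_def isometric_on_def intro: subspace_diff\<close>)
    then have "linear_isometry_on X N (A t)"
      by (intro Mazur_Ulam X) (simp_all add: A_def)
    then show ?thesis
      using iso unfolding isometry_property_def by blast
  qed
  have A_lim: "((\<lambda>t. A t x) \<longlongrightarrow> x) (at 0 within ?J)" if "x \<in> X" for x
    using tendsto_diff[OF \<alpha>_lim[OF that] \<alpha>_lim[OF 0]] by (simp add: A_def)
  (* The neighbourhood given by eventually_untwisted is punctured, so the values at 0 are prescribed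
     separately. *)
  define good where "good = (\<lambda>t u w. u \<in> unitary_matrices \<and> w \<in> unitary_matrices \<and>
    (\<forall>x\<in>X. A t x = u ** x ** w) \<and> u $ i\<^sub>1 $ i\<^sub>1 = of_real (norm (u $ i\<^sub>1 $ i\<^sub>1)) \<and>
    (t = 0 \<longrightarrow> u = mat 1 \<and> w = mat 1))"
  have good0: "good 0 (mat 1) (mat 1)"
    using \<alpha>0 0 by (simp add: good_def A_def mat_unitary_iff) (simp add: mat_def)
  obtain d where d: "d > 0" "\<And>t. t \<in> ?J \<Longrightarrow> t \<noteq> 0 \<Longrightarrow> dist t 0 < d \<Longrightarrow>
      \<exists>u\<in>unitary_matrices. \<exists>w\<in>unitary_matrices. \<forall>x\<in>X. A t x = u ** x ** w"
    using eventually_untwisted[OF \<Gamma> rep A_lim] unfolding eventually_at by blast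
  define T where "T = ?J \<inter> ball 0 d"
  have T: "T \<subseteq> ?J" "0 \<in> T"
    using d(1) by (auto simp: T_def)
  have "0 \<in> interior T"
    using d(1) by (simp add: T_def interior_open)
  have "\<exists>u w. good t u w" if t: "t \<in> T" for t
  proof (cases "t = 0")
    case False
    then obtain u w where uw: "u \<in> unitary_matrices" "w \<in> unitary_matrices" "\<forall>x\<in>X. A t x = u ** x ** w"
      using d(2)[of t] t by (auto simp: T_def)
    obtain u' w' where "u' \<in> unitary_matrices" "w' \<in> unitary_matrices"
      "\<And>x. u' ** x ** w' = u ** x ** w" "u' $ i\<^sub>1 $ i\<^sub>1 = of_real (norm (u' $ i\<^sub>1 $ i\<^sub>1))"
      using phase_normalization[OF uw(1,2)] by metis
    then have "good t u' w'"
      using False uw(3) by (simp add: good_def)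
    then show ?thesis
      by blast
  qed (use good0 in blast)
  then obtain u w where uw: "\<And>t. t \<in> T \<Longrightarrow> good t (u t) (w t)"
    by metis
  have A_eq: "A t x = u t ** x ** w t" if "t \<in> T" "x \<in> X" for t x
    using uw[OF that(1)] that(2) by (simp add: good_def)
  have uw0: "u 0 = mat 1" "w 0 = mat 1"
    using uw[OF T(2)] by (simp_all add: good_def)
  have uw_lim: "((\<lambda>t. u t ** x ** w t) \<longlongrightarrow> x) (at 0 within T)" if "x \<in> X" for x
    by (rule Lim_transform_eventually[OF tendsto_within_subset[OF A_lim[OF that] T(1)]])
      (auto simp: eventually_at_filter A_eq that)
  have "(u \<longlongrightarrow> mat 1) (at 0 within T)" "(w \<longlongrightarrow> mat 1) (at 0 within T)"
    by (rule normalized_representation_tendsto[OF \<Gamma>, of T u w i\<^sub>1 0];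
        use uw uw_lim in \<open>simp add: good_def\<close>)+
  then have cont: "continuous (at 0 within T) u" "continuous (at 0 within T) w"
    by (simp_all add: continuous_within uw0)
  have c_diff: "path_differentiable_at X N T (\<alpha> 0) 0"
    using path_differentiable_at_subset[OF \<alpha>_diff[OF 0] T(1)] .
  have uw_diff: "path_differentiable_at X N T (\<lambda>t. u t ** x ** w t) 0" if "x \<in> X" for x
  proof (rule path_differentiable_at_cong[OF _ _ T(2)])
    show "path_differentiable_at X N T (\<lambda>t. \<alpha> x t - \<alpha> 0 t) 0"
      by (intro path_differentiable_at_diff X path_differentiable_at_subset[OF _ T(1)] \<alpha>_diff that 0)
    show "\<alpha> x t - \<alpha> 0 t = u t ** x ** w t" if "t \<in> T" for t
      using A_eq[OF that \<open>x \<in> X\<close>] by (simp add: A_def)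
  qed
  have \<alpha>_eq: "\<alpha> x t = u t ** x ** w t + \<alpha> 0 t" if "x \<in> X" "t \<in> T" for x t
    using A_eq[OF that(2,1)] by (simp add: A_def algebra_simps)
  have mem: "u t \<in> unitary_matrices \<and> w t \<in> unitary_matrices \<and> \<alpha> 0 t \<in> X" if "t \<in> T" for t
    using uw[OF that] \<alpha>X[OF 0] that T(1) by (auto simp: good_def)
  show ?thesis
    by (rule exI[of _ T], rule exI[of _ u], rule exI[of _ w], rule exI[of _ "\<alpha> 0"], intro conjI ballI)
      (fact T(1) \<open>0 \<in> interior T\<close> uw0 \<alpha>0[OF 0] cont c_diff uw_diff \<alpha>_eq mem[THEN conjunct1]
        mem[THEN conjunct2, THEN conjunct1] mem[THEN conjunct2, THEN conjunct2])+
qed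

end
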